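(* Let $k\in\{3,4\}$. Let $f$ be a $k$-monotone probability on $\mathbb{N}$ with finite support, let $s_f$ and $\tilde s$ be the maxima of the supports of $f$ and of $\tilde p$, and let $s'=\max\{s_f,\tilde s\}$. The following two assertions are equivalent: (1) $f$ satisfies all of: (a) for all $l\in\mathbb{N}$ with $l\le s'+1$, $F^k_f(l)-F^k_{\tilde p}(l)\ge \beta(f)\,m^k_l$; (b) if $l$ is a $k$-knot of $f$, the inequality in (a) is an equality; (c) for all $2\le j\le k-1$, $F^j_f(s'+1)-F^j_{\tilde p}(s'+1)\ge \beta(f)\,m^j_{s'+1}$; (d) $\beta(f)\le 0$. (2) $f=\hat p$.
   Context: $\mathbb{N}=\{0,1,2,\dots\}$. For a real sequence $f=(f(i))_{i\in\mathbb{N}}$, put $\Delta^1 f(i)=f(i+1)-f(i)$ and $\Delta^{k}f(i)=\Delta^{k-1}f(i+1)-\Delta^{k-1}f(i)$. The sequence $f$ is $k$-monotone if $(-1)^k\Delta^k f(i)\ge 0$ for all $i\in\mathbb{N}$; a $k$-knot of a $k$-monotone $f$ is an integer $i\in\mathbb{N}$ with $(-1)^k\Delta^k f(i)>0$. $\mathcal{P}^k$ is the set of probability mass functions on $\mathbb{N}$ that are $k$-monotone. $X_1,\dots,X_n$ are $n\ge 1$ i.i.d. observations in $\mathbb{N}$, $\tilde p(j)=\frac1n\sum_{i=1}^n \mathbb{I}_{\{X_i=j\}}$ is the empirical probability mass function, and $\hat p=\operatorname{argmin}\{\|f-\tilde p\|_2^2 : f\in\mathcal{P}^k\}$, where $\|g\|_2^2=\sum_{i\ge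 0}g(i)^2$ (this minimizer exists and is unique). Iterated primitives: $F^1_f(l)=\sum_{i=0}^l f(i)$ and $F^j_f(l)=\sum_{i=0}^l F^{j-1}_f(i)$ for $j\ge 2$. Splines: for any integer $q\ge1$, $\bar Q^q_j(i)=\binom{j-i+q-1}{q-1}\mathbb{I}_{\{j\ge i\}}$ for $i,j\in\mathbb{N}$, with mass $m^q_j=\sum_{i=0}^j \bar Q^q_j(i)$. Finally $\beta(f)=\sum_{i=0}^\infty f(i)\,(f(i)-\tilde p(i))$. *)

theory Defs
  imports "HOL-Analysis.Analysis"
begin

text \<open>Iterated forward differences; the order-zero difference is the sequence itself.\<close>

primrec fdiff :: "nat \<Rightarrow> (nat \<Rightarrow> real) \<Rightarrow> nat \<Rightarrow> real" where
  "fdiff 0 f = f"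
| "fdiff (Suc k) f = (\<lambda>i. fdiff k f (i + 1) - fdiff k f i)"

definition k_monotone :: "nat \<Rightarrow> (nat \<Rightarrow> real) \<Rightarrow> bool" where
  "k_monotone k f \<longleftrightarrow> (\<forall>i. (-1) ^ k * fdiff k f i \<ge> 0)"

definition k_knot :: "nat \<Rightarrow> (nat \<Rightarrow> real) \<Rightarrow> nat \<Rightarrow> bool" where
  "k_knot k f i \<longleftrightarrow> (-1) ^ k * fdiff k f i > 0"

definition prob_mass :: "(nat \<Rightarrow> real) \<Rightarrow> bool" where
  "prob_mass f \<longleftrightarrow> (\<forall>i. f i \<ge> 0) \<and> f sums 1"

definition k_mono_probs :: "nat \<Rightarrow> (nat \<Rightarrow> real) set" where
  "k_mono_probs k = {f. prob_mass f \<and> k_monotone k f}"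

definition supp :: "(nat \<Rightarrow> real) \<Rightarrow> nat set" where
  "supp f = {i. f i \<noteq> 0}"

text \<open>The sample is \<open>X 1, \<dots>, X n\<close>; other values of \<open>X\<close> are irrelevant.\<close>

definition emp :: "nat \<Rightarrow> (nat \<Rightarrow> nat) \<Rightarrow> nat \<Rightarrow> real" where
  "emp n X j = (1 / real n) * (\<Sum>i=1..n. of_bool (X i = j))"

definition sq_dist :: "(nat \<Rightarrow> real) \<Rightarrow> (nat \<Rightarrow> real) \<Rightarrow> real" where
  "sq_dist f g = (\<Sum>i. (f i - g i)\<^sup>2)"

definition lse :: "nat \<Rightarrow> nat \<Rightarrow> (nat \<Rightarrow> nat) \<Rightarrow> nat \<Rightarrow> real" where
  "lse k n X = arg_min (\<lambda>f. sq_dist f (emp n X)) (\<lambda>f. f \<in> k_mono_probs k)"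

text \<open>Iterated primitives; the order-zero primitive is the sequence itself.\<close>

primrec primitive :: "nat \<Rightarrow> (nat \<Rightarrow> real) \<Rightarrow> nat \<Rightarrow> real" where
  "primitive 0 f = f"
| "primitive (Suc j) f = (\<lambda>l. \<Sum>i=0..l. primitive j f i)"

text \<open>Intended for orders \<open>q \<ge> 1\<close>, where the subtractions on \<^typ>\<open>nat\<close> do not truncate.\<close>

definition spline :: "nat \<Rightarrow> nat \<Rightarrow> nat \<Rightarrow> real" where
  "spline q j i = (if i \<le> j then real ((j - i + q - 1) choose (q - 1)) else 0)"

definition spline_mass :: "nat \<Rightarrow> nat \<Rightarrow> real" where
  "spline_mass q j = (\<Sum>i=0..j. spline q j i)"

definition beta_coef :: "(nat \<Rightarrow> real) \<Rightarrow> (nat \<Rightarrow> real) \<Rightarrow> real" where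
  "beta_coef p f = (\<Sum>i. f i * (f i - p i))"

end

theory Submission
  imports Defs
begin

text \<open>
  Put \<open>u = f - p - \<beta>\<close> and \<open>H\<^sub>j = primitive j u\<close>, so that
  \<open>H\<^sub>j(l) = F\<^sup>j\<^sub>f(l) - F\<^sup>j\<^sub>p(l) - \<beta> m\<^sup>j\<^sub>l\<close>. By convexity \<open>f\<close> is the minimizer iff
  \<open>\<Sum> u g \<ge> 0\<close> for every \<open>k\<close>-monotone probability \<open>g\<close>. Summing \<open>\<Sum>\<^bsub>i\<le>N\<^esub> u g\<close> by parts \<open>k\<close> times
  gives \<open>\<Sum>\<^bsub>i\<le>N\<^esub> H\<^sub>k (-1)\<^sup>k\<Delta>\<^sup>k g\<close> plus boundary terms in \<open>H\<^sub>1(N), \<dots>, H\<^sub>k(N)\<close>, whose signs are controlled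
  by (a), (c) and (d). Conversely, testing with splines gives \<open>H\<^sub>k \<ge> 0\<close>; testing with \<open>f\<close> itself, where
  \<open>\<Sum> u f = 0\<close>, gives the equality at knots; \<open>\<beta> > 0\<close> would drive \<open>H\<^sub>k\<close> to \<open>-\<infinity>\<close>; and (c) follows
  from \<open>H\<^sub>k\<close> vanishing at the last knot. A minimizer exists because the \<open>k\<close>-monotone sub-probabilities
  form a closed convex set, and the one closest to \<open>p\<close> cannot have mass below \<open>1\<close>, since its primitives of order \<open>k\<close>
  must dominate those of \<open>p\<close>.
\<close>

section \<open>Iterated differences and primitives\<close>

lemma fdiff_add: "fdiff k (\<lambda>i. a i + b i) i = fdiff k a i + fdiff k b i"
  by (induction k arbitrary: i) (auto simp: algebra_simps)

lemma fdiff_cmult: "fdiff k (\<lambda>i. c * a i) i = c * fdiff k a i"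
  by (induction k arbitrary: i) (auto simp: algebra_simps)

lemma tendsto_fdiff:
  assumes "\<And>i. (\<lambda>m. F m i) \<longlonglongrightarrow> g i"
  shows "(\<lambda>m. fdiff k (F m) i) \<longlonglongrightarrow> fdiff k g i"
  by (induction k arbitrary: i) (auto intro!: tendsto_intros assms)

lemma fdiff_tendsto_0:
  assumes "g \<longlonglongrightarrow> 0"
  shows "fdiff k g \<longlonglongrightarrow> 0"
proof (induction k)
  case (Suc k)
  have "(\<lambda>i. fdiff k g (i + 1) - fdiff k g i) \<longlonglongrightarrow> 0 - 0"
    by (intro tendsto_diff LIMSEQ_ignore_initial_segment Suc)
  then show ?case by simp
qed (use assms in simp)

lemma fdiff_eq_0:
  assumes "\<And>i. i > s \<Longrightarrow> g i = 0" and "i > s"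
  shows "fdiff k g i = 0"
  using assms(2) by (induction k arbitrary: i) (auto intro: assms(1))

text \<open>All differences vanish at \<open>Suc s\<close>, so raising the order at \<open>s\<close>
  only flips the sign. This makes the last support point of a nonnegative sequence a knot of every
  order.\<close>

lemma fdiff_at_last:
  assumes "\<And>i. i > s \<Longrightarrow> g i = 0"
  shows "(-1) ^ k * fdiff k g s = g s"
proof (induction k)
  case (Suc k)
  have "fdiff k g (Suc s) = 0"
    using assms lessI by (rule fdiff_eq_0)
  with Suc show ?case by (simp add: algebra_simps)
qed simp

lemma k_monotone_lincomb:
  assumes "k_monotone k a" "k_monotone k b" "c \<ge> 0" "d \<ge> 0"
  shows "k_monotone k (\<lambda>i. c * a i + d * b i)"
  unfolding k_monotone_def
proof
  fix i
  have "(-1) ^ k * fdiff k (\<lambda>i. c * a i + d * b i) i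
      = c * ((-1) ^ k * fdiff k a i) + d * ((-1) ^ k * fdiff k b i)"
    by (simp add: fdiff_add fdiff_cmult algebra_simps)
  also have "\<dots> \<ge> 0"
    using assms by (simp add: k_monotone_def)
  finally show "0 \<le> (-1) ^ k * fdiff k (\<lambda>i. c * a i + d * b i) i" .
qed

text \<open>Downward induction on the order: (j+1)-monotonicity says that the signed difference of
  order j decreases, and a decreasing sequence with limit 0 is nonnegative.\<close>

lemma k_monotone_lower:
  assumes "k_monotone k g" "g \<longlonglongrightarrow> 0" "j \<le> k"
  shows "k_monotone j g"
  using assms(3)
proof (induction rule: inc_induct)
  case (step j)
  let ?d = "\<lambda>i. (-1) ^ j * fdiff j g i"
  have "decseq ?d"
    using step.IH by (intro decseq_SucI) (simp add: k_monotone_def algebra_simps)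
  moreover have "?d \<longlonglongrightarrow> (-1) ^ j * 0"
    by (intro tendsto_mult tendsto_const fdiff_tendsto_0 assms)
  ultimately show ?case
    unfolding k_monotone_def by (metis decseq_ge mult_zero_right)
qed (use assms in simp)

section \<open>Linearity and growth of iterated primitives\<close>

lemma primitive_diff: "primitive j (\<lambda>i. a i - b i) l = primitive j a l - primitive j b l"
  by (induction j arbitrary: l) (auto simp: sum_subtractf)

lemma primitive_cmult: "primitive j (\<lambda>i. c * a i) l = c * primitive j a l"
  by (induction j arbitrary: l) (auto simp: sum_distrib_left)

lemma primitive_Suc_Suc: "primitive (Suc j) a (Suc l) = primitive (Suc j) a l + primitive j a (Suc l)"
  by simp

text \<open>The increments of \<open>primitive (Suc j) a\<close> after \<open>l\<close> are values
  of \<open>primitive j a\<close> at indices from \<open>Suc l\<close> on, so nonnegativity may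
  start one index later than the monotonicity.\<close>

lemma primitive_nonneg_mono:
  assumes "\<And>l. l \<ge> N \<Longrightarrow> primitive j a l \<ge> 0" "N \<le> Suc l" "l \<le> l'"
  shows "primitive (Suc j) a l \<le> primitive (Suc j) a l'"
  using assms(3)
proof (induction rule: dec_induct)
  case (step n)
  have "primitive j a (Suc n) \<ge> 0"
    using step.hyps assms(2) by (intro assms(1)) simp
  with step.IH show ?case by (simp only: primitive_Suc_Suc)
qed simp

lemma primitive_eventually_pos_Suc:
  assumes "\<delta> > 0" "eventually (\<lambda>l. primitive j a l \<ge> \<delta>) sequentially"
  shows "eventually (\<lambda>l. primitive (Suc j) a l \<ge> 1) sequentially"
proof -
  obtain N where N: "\<And>l. l \<ge> N \<Longrightarrow> primitive j a l \<ge> \<delta>"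
    using assms(2) by (auto simp: eventually_sequentially)
  have lower: "primitive (Suc j) a (N + m) \<ge> primitive (Suc j) a N + \<delta> * real m" for m
  proof (induction m)
    case (Suc m)
    have "primitive j a (Suc (N + m)) \<ge> \<delta>"
      by (rule N) simp
    with Suc show ?case
      by (simp only: primitive_Suc_Suc add_Suc_right of_nat_Suc distrib_left)
  qed simp
  obtain M :: nat where M: "(1 - primitive (Suc j) a N) / \<delta> < real M"
    using reals_Archimedean2 by blast
  show ?thesis
  proof (rule eventually_sequentiallyI)
    fix l assume "l \<ge> N + M"
    then obtain m where m: "l = N + m" "m \<ge> M"
      by (metis add.assoc le_Suc_ex le_add1)
    have "1 - primitive (Suc j) a N \<le> \<delta> * real M"
      using M assms(1) by (simp add: field_simps)
    also have "\<dots> \<le> \<delta> * real m"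
      using m assms(1) by simp
    finally show "primitive (Suc j) a l \<ge> 1"
      using lower[of m] m(1) by simp
  qed
qed

text \<open>A sequence that eventually stays above a positive constant has divergent partial sums,
  so the property passes to every higher primitive. It refutes both a deficient mass and a positive
  \<open>beta_coef p f\<close>.\<close>

lemma primitive_eventually_pos:
  assumes "\<delta> > 0" "eventually (\<lambda>l. primitive j a l \<ge> \<delta>) sequentially" "j \<le> k"
  shows "\<exists>\<delta>'>0. eventually (\<lambda>l. primitive k a l \<ge> \<delta>') sequentially"
  using assms(3)
proof (induction rule: dec_induct)
  case (step k)
  then show ?case
    using primitive_eventually_pos_Suc zero_less_one by blast
qed (use assms in blast)

section \<open>Summation by parts\<close>

lemma sum_mult_by_parts:
  fixes v w :: "nat \<Rightarrow> real"
  shows "(\<Sum>i=0..N. v i * w i) =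
    (\<Sum>i=0..N. v i) * w (Suc N) + (\<Sum>i=0..N. (\<Sum>m=0..i. v m) * (w i - w (Suc i)))"
  by (induction N) (auto simp: algebra_simps)

lemma sum_mult_iterated_by_parts:
  "(\<Sum>i=0..N. u i * g i) =
    (\<Sum>j<k. primitive (Suc j) u N * ((-1) ^ j * fdiff j g (Suc N)))
    + (\<Sum>i=0..N. primitive k u i * ((-1) ^ k * fdiff k g i))"
proof (induction k)
  case (Suc k)
  have "(\<Sum>i=0..N. primitive k u i * ((-1) ^ k * fdiff k g i)) =
    primitive (Suc k) u N * ((-1) ^ k * fdiff k g (Suc N))
    + (\<Sum>i=0..N. primitive (Suc k) u i * ((-1) ^ Suc k * fdiff (Suc k) g i))"
    unfolding sum_mult_by_parts[of "primitive k u" "\<lambda>i. (-1) ^ k * fdiff k g i" N]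
    by (simp add: algebra_simps)
  then show ?case using Suc.IH by simp
qed simp

lemma sum_mult_eq_primitive_fdiff:
  assumes "\<And>i. i > N \<Longrightarrow> g i = 0"
  shows "(\<Sum>i=0..N. u i * g i) = (\<Sum>i=0..N. primitive k u i * ((-1) ^ k * fdiff k g i))"
proof -
  have "fdiff j g (Suc N) = 0" for j
    using assms lessI by (rule fdiff_eq_0)
  then show ?thesis
    using sum_mult_iterated_by_parts[of u g N k] by simp
qed

section \<open>Splines\<close>

text \<open>Pascal's rule for the binomial coefficients.\<close>

lemma spline_diff:
  "spline (Suc (Suc q)) l i - spline (Suc (Suc q)) l (Suc i) = spline (Suc q) l i"
proof (cases "Suc i \<le> l")
  case True
  then obtain d where "l = Suc i + d"
    using le_Suc_ex by blast
  then show ?thesis by (simp add: spline_def)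
qed (auto simp: spline_def)

lemma fdiff_spline:
  "j \<le> q \<Longrightarrow> (-1) ^ j * fdiff j (spline (Suc q) l) i = spline (Suc (q - j)) l i"
proof (induction j arbitrary: i)
  case (Suc j)
  then have q: "q - j = Suc (q - Suc j)" by simp
  have "(-1) ^ Suc j * fdiff (Suc j) (spline (Suc q) l) i
      = spline (Suc (q - j)) l i - spline (Suc (q - j)) l (Suc i)"
    using Suc.IH[of i] Suc.IH[of "Suc i"] Suc.prems by (simp add: algebra_simps)
  also have "\<dots> = spline (Suc (q - Suc j)) l i"
    unfolding q by (rule spline_diff)
  finally show ?case .
qed simp

text \<open>Each signed difference lowers the order of a spline by one, and order 1 is the indicator
  of i \<le> l. Hence the splines are the Green functions of the signed difference of order
  k.\<close>

lemma fdiff_spline_self: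
  assumes "k \<ge> 1"
  shows "(-1) ^ k * fdiff k (spline k l) i = of_bool (i = l)"
proof -
  obtain q where q: "k = Suc q"
    using assms by (cases k) auto
  have "(-1) ^ k * fdiff k (spline k l) i = spline 1 l i - spline 1 l (Suc i)"
    using fdiff_spline[of q q l i] fdiff_spline[of q q l "Suc i"]
    by (simp add: q algebra_simps)
  then show ?thesis by (auto simp: spline_def)
qed

lemma spline_nonneg: "spline k l i \<ge> 0"
  by (simp add: spline_def)

lemma spline_eq_0: "i > l \<Longrightarrow> spline k l i = 0"
  by (simp add: spline_def)

lemma k_monotone_spline: "k \<ge> 1 \<Longrightarrow> k_monotone k (spline k l)"
  by (simp add: k_monotone_def fdiff_spline_self)

text \<open>Summation by parts moves all differences onto the spline and leaves a unit mass at
  \<open>l\<close>: testing against a spline evaluates an iterated primitive.\<close>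

lemma sum_mult_spline:
  assumes "k \<ge> 1"
  shows "(\<Sum>i=0..l. u i * spline k l i) = primitive k u l"
proof -
  have "(\<Sum>i=0..l. u i * spline k l i) = (\<Sum>i=0..l. primitive k u i * of_bool (i = l))"
    by (simp only: sum_mult_eq_primitive_fdiff[OF spline_eq_0, where k = k] fdiff_spline_self[OF assms])
  also have "\<dots> = (\<Sum>i\<in>{l}. primitive k u i * of_bool (i = l))"
    by (intro sum.mono_neutral_right) auto
  finally show ?thesis by simp
qed

lemma spline_mass_eq_primitive:
  assumes "k \<ge> 1"
  shows "spline_mass k l = primitive k (\<lambda>_. 1) l"
  using sum_mult_spline[OF assms, where u = "\<lambda>_. 1"] by (simp add: spline_mass_def)

lemma spline_mass_pos:
  assumes "k \<ge> 1"
  shows "spline_mass k l > 0"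
proof -
  have "spline k l l \<le> spline_mass k l"
    unfolding spline_mass_def by (intro member_le_sum) (auto simp: spline_nonneg)
  moreover have "spline k l l = 1"
    using assms by (simp add: spline_def)
  ultimately show ?thesis by simp
qed

lemma spline_sums: "spline k l sums spline_mass k l"
  unfolding spline_mass_def by (rule sums_finite) (auto simp: spline_eq_0)

lemma normalized_spline_in_k_mono_probs:
  assumes "k \<ge> 1"
  shows "(\<lambda>i. (1 / spline_mass k l) * spline k l i) \<in> k_mono_probs k"
proof -
  define c where "c = 1 / spline_mass k l"
  have c: "c \<ge> 0" "c * spline_mass k l = 1"
    using spline_mass_pos[OF assms, of l] by (auto simp: c_def)
  have "(\<lambda>i. c * spline k l i) sums 1"
    using sums_mult[OF spline_sums, of c k l] c(2) by simp
  moreover have "k_monotone k (\<lambda>i. c * spline k l i)"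
    using k_monotone_lincomb[of k "spline k l" "spline k l" c 0] k_monotone_spline[OF assms] c(1)
    by simp
  ultimately show ?thesis
    using c(1) by (simp add: k_mono_probs_def prob_mass_def spline_nonneg flip: c_def)
qed

section \<open>Quadratic minimisation over sequences\<close>

lemma summable_mult_of_squares:
  fixes a b :: "nat \<Rightarrow> real"
  assumes "summable (\<lambda>i. (a i)\<^sup>2)" "summable (\<lambda>i. (b i)\<^sup>2)"
  shows "summable (\<lambda>i. a i * b i)"
proof (rule summable_comparison_test')
  show "summable (\<lambda>i. (a i)\<^sup>2 + (b i)\<^sup>2)"
    by (intro summable_add assms)
  show "norm (a i * b i) \<le> (a i)\<^sup>2 + (b i)\<^sup>2" for i
    using sum_squares_bound[of "\<bar>a i\<bar>" "\<bar>b i\<bar>"] abs_ge_zero[of "a i * b i"]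
    by (simp only: abs_mult real_norm_def power2_abs)
qed

lemma sums_square_add:
  fixes a b :: "nat \<Rightarrow> real"
  assumes "summable (\<lambda>i. (a i)\<^sup>2)" "summable (\<lambda>i. (b i)\<^sup>2)"
  shows "(\<lambda>i. (a i + t * b i)\<^sup>2) sums
    ((\<Sum>i. (a i)\<^sup>2) + 2 * t * (\<Sum>i. a i * b i) + t\<^sup>2 * (\<Sum>i. (b i)\<^sup>2))"
proof -
  have "(\<lambda>i. (a i)\<^sup>2 + 2 * t * (a i * b i) + t\<^sup>2 * (b i)\<^sup>2) sums
    ((\<Sum>i. (a i)\<^sup>2) + 2 * t * (\<Sum>i. a i * b i) + t\<^sup>2 * (\<Sum>i. (b i)\<^sup>2))"
    by (intro sums_add sums_mult summable_sums assms summable_mult_of_squares)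
  then show ?thesis
    by (simp add: power2_eq_square algebra_simps)
qed

lemma first_order_condition:
  fixes a b :: "nat \<Rightarrow> real"
  assumes "summable (\<lambda>i. (a i)\<^sup>2)" "summable (\<lambda>i. (b i)\<^sup>2)" "\<epsilon> > 0"
    and min: "\<And>t. 0 < t \<Longrightarrow> t \<le> \<epsilon> \<Longrightarrow> (\<Sum>i. (a i)\<^sup>2) \<le> (\<Sum>i. (a i + t * b i)\<^sup>2)"
  shows "(\<Sum>i. a i * b i) \<ge> 0"
proof (rule ccontr)
  let ?S = "\<Sum>i. a i * b i" and ?B = "\<Sum>i. (b i)\<^sup>2"
  assume neg: "\<not> ?S \<ge> 0"
  have B: "?B \<ge> 0"
    by (intro suminf_nonneg assms) simp
  \<comment> \<open>This \<open>t\<close> makes 2S + tB smaller than S < 0; the added 1 covers the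
    case B = 0.\<close>
  define t where "t = min \<epsilon> (- ?S / (?B + 1))"
  have t: "0 < t" "t \<le> \<epsilon>"
    using neg B assms(3) by (auto simp: t_def field_simps)
  have "t * (?B + 1) \<le> - ?S"
    using B by (simp add: t_def pos_le_divide_eq[symmetric])
  with t B neg have "2 * ?S + t * ?B < 0"
    by (simp add: algebra_simps)
  then have "t * (2 * ?S + t * ?B) < 0"
    using t by (simp add: mult_pos_neg)
  moreover have "(\<Sum>i. (a i + t * b i)\<^sup>2) = (\<Sum>i. (a i)\<^sup>2) + t * (2 * ?S + t * ?B)"
    using sums_unique[OF sums_square_add[OF assms(1,2), of t]]
    by (simp add: algebra_simps power2_eq_square)
  ultimately show False
    using min[OF t] by simp
qed

text \<open>The parallelogram identity, with the squared norm of the difference bounded below by one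
  coordinate. It will make minimizing sequences Cauchy in each coordinate.\<close>

lemma parallelogram_suminf:
  fixes a b :: "nat \<Rightarrow> real"
  assumes "summable (\<lambda>i. (a i)\<^sup>2)" "summable (\<lambda>i. (b i)\<^sup>2)"
  shows "(a m - b m)\<^sup>2 \<le> 2 * (\<Sum>i. (a i)\<^sup>2) + 2 * (\<Sum>i. (b i)\<^sup>2) - 4 * (\<Sum>i. ((a i + b i) / 2)\<^sup>2)"
proof -
  have plus: "(\<lambda>i. (a i + b i)\<^sup>2) sums ((\<Sum>i. (a i)\<^sup>2) + 2 * (\<Sum>i. a i * b i) + (\<Sum>i. (b i)\<^sup>2))"
    using sums_square_add[OF assms, of 1] by simp
  have minus: "(\<lambda>i. (a i - b i)\<^sup>2) sums ((\<Sum>i. (a i)\<^sup>2) - 2 * (\<Sum>i. a i * b i) + (\<Sum>i. (b i)\<^sup>2))"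
    using sums_square_add[OF assms, of "-1"] by simp
  have half: "(\<lambda>i. ((a i + b i) / 2)\<^sup>2) sums
      ((1/4) * ((\<Sum>i. (a i)\<^sup>2) + 2 * (\<Sum>i. a i * b i) + (\<Sum>i. (b i)\<^sup>2)))"
    using sums_mult[OF plus, of "1/4"] by (simp add: power_divide)
  have "(a m - b m)\<^sup>2 \<le> (\<Sum>i. (a i - b i)\<^sup>2)"
    using sum_le_suminf[OF sums_summable[OF minus], of "{m}"] by simp
  also have "\<dots> = (\<Sum>i. (a i)\<^sup>2) - 2 * (\<Sum>i. a i * b i) + (\<Sum>i. (b i)\<^sup>2)"
    using minus by (simp add: sums_iff)
  finally show ?thesis
    using sums_unique[OF half] by (simp add: field_simps)
qed

text \<open>The projection argument with pointwise limits: midpoints lie in \<open>C\<close>, so a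
  minimizing sequence is Cauchy in each coordinate, and its limit attains the infimum by lower
  semicontinuity.\<close>

lemma sq_dist_minimizer_exists:
  assumes nonempty: "C \<noteq> {}"
    and summ: "\<And>g. g \<in> C \<Longrightarrow> summable (\<lambda>i. (g i - p i)\<^sup>2)"
    and midpoint: "\<And>g h. g \<in> C \<Longrightarrow> h \<in> C \<Longrightarrow> (\<lambda>i. (g i + h i) / 2) \<in> C"
    and closed: "\<And>F g. (\<And>m. F m \<in> C) \<Longrightarrow> (\<And>i. (\<lambda>m. F m i) \<longlonglongrightarrow> g i) \<Longrightarrow> g \<in> C"
  obtains g where "g \<in> C" "\<And>h. h \<in> C \<Longrightarrow> sq_dist g p \<le> sq_dist h p"
proof -
  define d where "d = (INF g\<in>C. sq_dist g p)"
  have bdd: "bdd_below ((\<lambda>g. sq_dist g p) ` C)"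
    using summ by (intro bdd_belowI2[where m = 0]) (auto simp: sq_dist_def intro: suminf_nonneg)
  have d_le: "d \<le> sq_dist g p" if "g \<in> C" for g
    unfolding d_def using bdd that by (rule cINF_lower)
  have "\<exists>g\<in>C. sq_dist g p < d + 1 / real (Suc m)" for m
    using nonempty bdd by (subst cINF_less_iff[symmetric]) (auto simp: d_def)
  then obtain F where F: "\<And>m. F m \<in> C" "\<And>m. sq_dist (F m) p < d + 1 / real (Suc m)"
    by metis
  \<comment> \<open>With e = 1/(N+1), the parallelogram bound is 2(d + e) + 2(d + e) - 4d = 4e,
    because the midpoint has distance at least \<open>d\<close>.\<close>
  have close: "(F m i - F n i)\<^sup>2 \<le> 4 / real (Suc N)" if "m \<ge> N" "n \<ge> N" for m n N i
  proof -
    have "sq_dist (\<lambda>i. (F m i + F n i) / 2) p = (\<Sum>i. (((F m i - p i) + (F n i - p i)) / 2)\<^sup>2)"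
      unfolding sq_dist_def by (intro suminf_cong) (simp add: field_simps)
    moreover have "sq_dist (F j) p \<le> d + 1 / real (Suc N)" if "j \<ge> N" for j
    proof -
      have "1 / real (Suc j) \<le> 1 / real (Suc N)"
        using that by (intro divide_left_mono) auto
      then show ?thesis using F(2)[of j] by simp
    qed
    moreover from this have "sq_dist (F m) p \<le> d + 1 / real (Suc N)"
      "sq_dist (F n) p \<le> d + 1 / real (Suc N)"
      using that by blast+
    ultimately show ?thesis
      using parallelogram_suminf[OF summ[OF F(1)] summ[OF F(1)], of m i n]
        d_le[OF midpoint[OF F(1) F(1)], of m n]
      by (simp add: sq_dist_def)
  qed
  have "Cauchy (\<lambda>m. F m i)" for i
  proof (rule metric_CauchyI)
    fix e :: real assume e: "e > 0"
    obtain N :: nat where "4 / e\<^sup>2 < real N"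
      using reals_Archimedean2 by blast
    then have "4 / real (Suc N) < e\<^sup>2"
      using e by (simp add: field_simps) (smt (verit) zero_less_power)
    then have "(F m i - F n i)\<^sup>2 < e\<^sup>2" if "m \<ge> N" "n \<ge> N" for m n
      using close[OF that, of i] by simp
    then have "dist (F m i) (F n i) < e" if "m \<ge> N" "n \<ge> N" for m n
      using that e by (simp add: dist_real_def) (metis abs_of_pos power2_abs power2_less_imp_less less_imp_le)
    then show "\<exists>M. \<forall>m\<ge>M. \<forall>n\<ge>M. dist (F m i) (F n i) < e" by blast
  qed
  then have "\<exists>g. \<forall>i. (\<lambda>m. F m i) \<longlonglongrightarrow> g i"
    by (intro choice) (simp add: Cauchy_convergent_iff convergent_def)
  then obtain g where g: "\<And>i. (\<lambda>m. F m i) \<longlonglongrightarrow> g i"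
    by blast
  have gC: "g \<in> C"
    using closed[OF F(1) g] .
  \<comment> \<open>Pointwise convergence suffices for finite partial sums; their supremum then
    bounds the full distance.\<close>
  have "(\<Sum>i<N. (g i - p i)\<^sup>2) \<le> d" for N
  proof (rule tendsto_le[OF sequentially_bot])
    show "(\<lambda>m. \<Sum>i<N. (F m i - p i)\<^sup>2) \<longlonglongrightarrow> (\<Sum>i<N. (g i - p i)\<^sup>2)"
      by (intro tendsto_intros g)
    show "(\<lambda>m. d + 1 / real (Suc m)) \<longlonglongrightarrow> d"
      using tendsto_add[OF tendsto_const LIMSEQ_inverse_real_of_nat, of d] by (simp add: field_simps)
    have "(\<Sum>i<N. (F m i - p i)\<^sup>2) \<le> sq_dist (F m) p" for m
      unfolding sq_dist_def by (intro sum_le_suminf summ F) auto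
    then show "eventually (\<lambda>m. (\<Sum>i<N. (F m i - p i)\<^sup>2) \<le> d + 1 / real (Suc m)) sequentially"
      using F(2) by (intro always_eventually allI) (meson less_imp_le order_trans)
  qed
  then have "sq_dist g p \<le> d"
    unfolding sq_dist_def by (intro suminf_le_const summ gC)
  then show thesis
    using that[OF gC] d_le order_trans by blast
qed

section \<open>Existence of the least squares estimator\<close>

lemma prob_mass_le_1:
  assumes "prob_mass p"
  shows "p i \<le> 1"
  using assms sum_le_suminf[of p "{i}"] by (auto simp: prob_mass_def sums_iff)

lemma sum_le_of_prob_mass:
  assumes "prob_mass p"
  shows "(\<Sum>i<N. p i) \<le> 1"
  using assms sum_le_suminf[of p "{..<N}"] by (auto simp: prob_mass_def sums_iff)

lemma prob_mass_tendsto_0: "prob_mass g \<Longrightarrow> g \<longlonglongrightarrow> 0"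
  unfolding prob_mass_def by (auto intro: summable_LIMSEQ_zero sums_summable)

text \<open>Mass may escape to infinity along a sequence in \<^term>\<open>k_mono_probs k\<close>; the sub-probabilities
  form its closure under pointwise limits.\<close>

definition k_mono_subprobs :: "nat \<Rightarrow> (nat \<Rightarrow> real) set" where
  "k_mono_subprobs k = {g. (\<forall>i. g i \<ge> 0) \<and> (\<forall>N. (\<Sum>i<N. g i) \<le> 1) \<and> k_monotone k g}"

lemma k_mono_probs_subset: "k_mono_probs k \<subseteq> k_mono_subprobs k"
  using sum_le_of_prob_mass by (auto simp: k_mono_probs_def k_mono_subprobs_def prob_mass_def)

lemma k_mono_subprobs_summable:
  assumes "g \<in> k_mono_subprobs k"
  shows "summable g"
  using assms by (intro summableI_nonneg_bounded) (auto simp: k_mono_subprobs_def)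

lemma k_mono_subprobs_sq_summable:
  assumes "g \<in> k_mono_subprobs k" "prob_mass p"
  shows "summable (\<lambda>i. (g i - p i)\<^sup>2)"
proof (rule summable_comparison_test')
  show "summable (\<lambda>i. g i + p i)"
    using assms k_mono_subprobs_summable by (auto simp: prob_mass_def sums_iff intro: summable_add)
  fix i
  have g: "0 \<le> g i" "g i \<le> 1"
  proof -
    have "(\<Sum>j\<in>{i}. g j) \<le> (\<Sum>j<Suc i. g j)"
      using assms(1) by (intro sum_mono2) (auto simp: k_mono_subprobs_def)
    also have "\<dots> \<le> 1"
      using assms(1) unfolding k_mono_subprobs_def by blast
    finally show "g i \<le> 1" by simp
  qed (use assms in \<open>simp add: k_mono_subprobs_def\<close>)
  have p: "0 \<le> p i" "p i \<le> 1"
    using assms(2) prob_mass_le_1 by (auto simp: prob_mass_def)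
  have "(g i - p i)\<^sup>2 = \<bar>g i - p i\<bar> * \<bar>g i - p i\<bar>"
    by (simp add: power2_eq_square)
  also have "\<dots> \<le> 1 * (g i + p i)"
    using g p by (intro mult_mono) auto
  finally show "norm ((g i - p i)\<^sup>2) \<le> g i + p i" by simp
qed

text \<open>If the mass M were below 1, a small multiple of any spline could be added to
  \<open>g\<close>, and the first-order condition would make the primitives of order k of
  \<open>g\<close> dominate those of \<open>p\<close>. The missing mass makes the opposite strict
  inequality hold far out.\<close>

lemma k_mono_subprobs_minimizer_mass:
  assumes "k \<ge> 1" and p: "prob_mass p" "\<And>i. i > s \<Longrightarrow> p i = 0"
    and g: "g \<in> k_mono_subprobs k"
    and min: "\<And>h. h \<in> k_mono_subprobs k \<Longrightarrow> sq_dist g p \<le> sq_dist h p"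
  shows "g sums 1"
proof -
  define M where "M = suminf g"
  have gM: "g sums M"
    unfolding M_def using k_mono_subprobs_summable[OF g] by (rule summable_sums)
  have partial: "(\<Sum>i<N. g i) \<le> M" for N
    unfolding M_def using g
    by (intro sum_le_suminf k_mono_subprobs_summable) (auto simp: k_mono_subprobs_def)
  have "M \<le> 1"
    unfolding M_def using g
    by (intro suminf_le_const k_mono_subprobs_summable) (auto simp: k_mono_subprobs_def)
  moreover have False if "M < 1"
  proof -
    have le: "primitive k p l \<le> primitive k g l" for l
    proof -
      have "(\<Sum>i. (g i - p i) * spline k l i) \<ge> 0"
      proof (rule first_order_condition)
        show "summable (\<lambda>i. (g i - p i)\<^sup>2)"
          using g p(1) by (rule k_mono_subprobs_sq_summable)
        show "summable (\<lambda>i. (spline k l i)\<^sup>2)"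
          by (rule summable_finite[of "{..l}"]) (auto simp: spline_eq_0)
        \<comment> \<open>The largest step for which adding the spline keeps the total mass at most
          1.\<close>
        show "(1 - M) / spline_mass k l > 0"
          using that spline_mass_pos[OF assms(1)] by simp
        fix t assume t: "0 < t" "t \<le> (1 - M) / spline_mass k l"
        have "(\<Sum>i<N. g i + t * spline k l i) \<le> 1" for N
        proof -
          have "(\<Sum>i<N. spline k l i) \<le> spline_mass k l"
            using sum_le_suminf[OF sums_summable[OF spline_sums], of "{..<N}" k l]
              sums_unique[OF spline_sums, of k l] by (simp add: spline_nonneg)
          then have "t * (\<Sum>i<N. spline k l i) \<le> t * spline_mass k l"
            using t by simp
          also have "\<dots> \<le> 1 - M"
            using t spline_mass_pos[OF assms(1), of l] by (simp add: field_simps)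
          finally show ?thesis
            using partial[of N] by (simp add: sum.distrib sum_distrib_left)
        qed
        moreover have "k_monotone k (\<lambda>i. g i + t * spline k l i)"
          using g k_monotone_spline[OF assms(1), of l] t k_monotone_lincomb[of k g "spline k l" 1 t]
          by (simp add: k_mono_subprobs_def)
        ultimately have "(\<lambda>i. g i + t * spline k l i) \<in> k_mono_subprobs k"
          using g t by (simp add: k_mono_subprobs_def spline_nonneg)
        from min[OF this] show "(\<Sum>i. (g i - p i)\<^sup>2) \<le> (\<Sum>i. (g i - p i + t * spline k l i)\<^sup>2)"
          by (simp add: sq_dist_def algebra_simps)
      qed
      moreover have "(\<Sum>i. (g i - p i) * spline k l i) = (\<Sum>i=0..l. (g i - p i) * spline k l i)"
        by (rule suminf_finite) (auto simp: spline_eq_0)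
      ultimately show ?thesis
        by (simp add: sum_mult_spline[OF assms(1)] primitive_diff)
    qed
    \<comment> \<open>From \<open>s\<close> on, \<open>p\<close> has accumulated its full mass 1,
      whereas \<open>g\<close> never accumulates more than M.\<close>
    have "1 - M \<le> primitive 1 (\<lambda>i. p i - g i) l" if "l \<ge> s" for l
    proof -
      have "p sums (\<Sum>i=0..l. p i)"
        using that p(2) by (intro sums_finite) auto
      then have "(\<Sum>i=0..l. p i) = 1"
        using p(1) sums_unique2 by (auto simp: prob_mass_def)
      then show ?thesis
        using partial[of "Suc l"] by (simp add: sum_subtractf atLeast0AtMost lessThan_Suc_atMost)
    qed
    then have "eventually (\<lambda>l. 1 - M \<le> primitive 1 (\<lambda>i. p i - g i) l) sequentially"
      by (rule eventually_sequentiallyI)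
    from primitive_eventually_pos[OF _ this assms(1)] \<open>M < 1\<close>
    obtain \<delta> where "\<delta> > 0" "eventually (\<lambda>l. \<delta> \<le> primitive k (\<lambda>i. p i - g i) l) sequentially"
      by auto
    then obtain l where "\<delta> \<le> primitive k (\<lambda>i. p i - g i) l"
      by (auto simp: eventually_sequentially)
    with \<open>\<delta> > 0\<close> le[of l] show False by (simp add: primitive_diff)
  qed
  ultimately show ?thesis using gM by fastforce
qed

lemma k_mono_probs_minimizer_exists:
  assumes "k \<ge> 1" "prob_mass p" "\<And>i. i > s \<Longrightarrow> p i = 0"
  shows "\<exists>g\<in>k_mono_probs k. \<forall>h\<in>k_mono_probs k. sq_dist g p \<le> sq_dist h p"
proof -
  obtain g where g: "g \<in> k_mono_subprobs k"
    "\<And>h. h \<in> k_mono_subprobs k \<Longrightarrow> sq_dist g p \<le> sq_dist h p"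
  proof (rule sq_dist_minimizer_exists[of "k_mono_subprobs k" p])
    show "k_mono_subprobs k \<noteq> {}"
      using normalized_spline_in_k_mono_probs[OF assms(1)] k_mono_probs_subset by blast
    show "summable (\<lambda>i. (g i - p i)\<^sup>2)" if "g \<in> k_mono_subprobs k" for g
      using that assms(2) by (rule k_mono_subprobs_sq_summable)
    show "(\<lambda>i. (g i + h i) / 2) \<in> k_mono_subprobs k"
      if "g \<in> k_mono_subprobs k" "h \<in> k_mono_subprobs k" for g h
    proof -
      have "(\<lambda>i. (g i + h i) / 2) = (\<lambda>i. (1/2) * g i + (1/2) * h i)"
        by (simp add: add_divide_distrib)
      then have "k_monotone k (\<lambda>i. (g i + h i) / 2)"
        using that k_monotone_lincomb[of k g h "1/2" "1/2"] by (simp add: k_mono_subprobs_def)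
      moreover have "(\<Sum>i<N. (g i + h i) / 2) \<le> 1" for N
        using that add_mono[of "sum g {..<N}" 1 "sum h {..<N}" 1]
        by (simp add: k_mono_subprobs_def sum.distrib flip: sum_divide_distrib)
      ultimately show ?thesis
        using that by (simp add: k_mono_subprobs_def)
    qed
    show "g \<in> k_mono_subprobs k"
      if F: "\<And>m. F m \<in> k_mono_subprobs k" and lim: "\<And>i. (\<lambda>m. F m i) \<longlonglongrightarrow> g i" for F g
    proof -
      have "0 \<le> g i" for i
        using F by (intro LIMSEQ_le_const[OF lim]) (auto simp: k_mono_subprobs_def)
      moreover have "(\<Sum>i<N. g i) \<le> 1" for N
        using F by (intro LIMSEQ_le_const2[OF tendsto_sum[OF lim]]) (auto simp: k_mono_subprobs_def)
      moreover have "0 \<le> (-1) ^ k * fdiff k g i" for i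
        using F by (intro LIMSEQ_le_const[OF tendsto_mult[OF tendsto_const tendsto_fdiff[OF lim]]])
          (auto simp: k_mono_subprobs_def k_monotone_def)
      ultimately show ?thesis
        by (simp add: k_mono_subprobs_def k_monotone_def)
    qed
  qed blast
  have "g sums 1"
    using assms g by (rule k_mono_subprobs_minimizer_mass)
  then have "g \<in> k_mono_probs k"
    using g(1) by (simp add: k_mono_subprobs_def k_mono_probs_def prob_mass_def)
  then show ?thesis
    using g(2) k_mono_probs_subset by blast
qed

section \<open>Variational characterization of the estimator\<close>

lemma k_mono_probs_convex:
  assumes "f \<in> k_mono_probs k" "g \<in> k_mono_probs k" "0 \<le> t" "t \<le> 1"
  shows "(\<lambda>i. f i + t * (g i - f i)) \<in> k_mono_probs k"
proof -
  have eq: "(\<lambda>i. f i + t * (g i - f i)) = (\<lambda>i. (1 - t) * f i + t * g i)"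
    by (auto simp: algebra_simps)
  have "(\<lambda>i. (1 - t) * f i + t * g i) sums ((1 - t) * 1 + t * 1)"
    using assms(1,2) by (intro sums_add sums_mult) (auto simp: k_mono_probs_def prob_mass_def)
  then show ?thesis
    using assms k_monotone_lincomb[of k f g "1 - t" t]
    by (simp add: eq k_mono_probs_def prob_mass_def)
qed

lemma prob_mass_emp:
  assumes "n \<ge> 1"
  shows "prob_mass (emp n X)"
proof -
  have "(\<lambda>j. (1 / real n) * (\<Sum>i=1..n. of_bool (X i = j))) sums ((1 / real n) * (\<Sum>i=1..n. 1))"
  proof (intro sums_mult sums_sum)
    fix i
    have "(\<lambda>j. of_bool (X i = j) :: real) = (\<lambda>j. if j = X i then 1 else 0)"
      by auto
    then show "(\<lambda>j. of_bool (X i = j) :: real) sums 1"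
      using sums_single[of "X i" "\<lambda>_. 1 :: real"] by simp
  qed
  then show ?thesis
    using assms by (simp add: prob_mass_def emp_def[abs_def] sum_nonneg)
qed

lemma finite_supp_emp: "finite (supp (emp n X))"
proof (rule finite_subset)
  show "supp (emp n X) \<subseteq> X ` {1..n}"
  proof
    fix j assume "j \<in> supp (emp n X)"
    then have "(\<Sum>i=1..n. of_bool (X i = j) :: real) \<noteq> 0"
      by (auto simp: supp_def emp_def)
    then obtain i where "i \<in> {1..n}" "of_bool (X i = j) \<noteq> (0 :: real)"
      by (rule sum.not_neutral_contains_not_neutral)
    then show "j \<in> X ` {1..n}" by auto
  qed
qed simp

lemma gt_Max_supp:
  assumes "finite (supp f)" "i > Max (supp f)"
  shows "f i = 0"
  using assms Max_ge[of "supp f" i] leD unfolding supp_def by blast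

section \<open>First-order conditions at a fixed finitely supported candidate\<close>

locale finite_support_fit =
  fixes k s :: nat and p f :: "nat \<Rightarrow> real"
  assumes k: "k \<ge> 1"
    and p: "prob_mass p" "\<And>i. i > s \<Longrightarrow> p i = 0"
    and f: "f \<in> k_mono_probs k" "\<And>i. i > s \<Longrightarrow> f i = 0"
begin

text \<open>Half the gradient of the squared distance at \<open>f\<close>, shifted by the constant
  that makes its sum against \<open>f\<close> vanish.\<close>

definition resid :: "nat \<Rightarrow> real" where
  "resid i = f i - p i - beta_coef p f"

lemma primitive_resid:
  assumes "j \<ge> 1"
  shows "primitive j resid l = primitive j f l - primitive j p l - beta_coef p f * spline_mass j l"
proof -
  have "primitive j resid l
      = primitive j (\<lambda>i. (f i - p i) - beta_coef p f * 1) l"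
    by (simp add: resid_def[abs_def])
  then show ?thesis
    by (simp only: primitive_diff primitive_cmult spline_mass_eq_primitive[OF assms])
qed

lemma beta_coef_eq: "beta_coef p f = (\<Sum>i=0..s. f i * (f i - p i))"
  unfolding beta_coef_def using f(2) by (intro suminf_finite) auto

lemma sum_prob_eq_1:
  assumes "prob_mass q" "\<And>i. i > m \<Longrightarrow> q i = 0"
  shows "(\<Sum>i=0..m. q i) = 1"
proof -
  have "q sums (\<Sum>i=0..m. q i)"
    using assms(2) by (intro sums_finite) auto
  then show ?thesis
    using assms(1) sums_unique2 by (auto simp: prob_mass_def)
qed

lemma prob_mass_f: "prob_mass f"
  using f by (simp add: k_mono_probs_def)

lemma primitive_1_resid:
  assumes "l \<ge> s"
  shows "primitive 1 resid l = - beta_coef p f * real (Suc l)"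
proof -
  have "(\<Sum>i=0..l. f i) = 1" "(\<Sum>i=0..l. p i) = 1"
    using assms p f by (auto intro!: sum_prob_eq_1 prob_mass_f)
  then show ?thesis
    by (simp add: resid_def sum_subtractf)
qed

lemma sum_resid_mult_self:
  assumes "\<And>i. i > m \<Longrightarrow> f i = 0"
  shows "(\<Sum>i=0..m. resid i * f i) = 0"
proof -
  have "(\<Sum>i=0..m. f i * (f i - p i)) = beta_coef p f"
    unfolding beta_coef_def using assms by (intro suminf_finite[symmetric]) auto
  moreover have "(\<Sum>i=0..m. beta_coef p f * f i) = beta_coef p f"
    using sum_prob_eq_1[OF prob_mass_f assms] by (simp flip: sum_distrib_left)
  ultimately show ?thesis
    by (simp add: resid_def left_diff_distrib right_diff_distrib sum_subtractf mult.commute)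
qed

lemma summable_residual_sq: "summable (\<lambda>i. (f i - p i)\<^sup>2)"
  using f k_mono_probs_subset p by (blast intro: k_mono_subprobs_sq_summable)

lemma summable_diff_sq:
  assumes "g \<in> k_mono_probs k"
  shows "summable (\<lambda>i. (g i - f i)\<^sup>2)"
  using assms k_mono_probs_subset prob_mass_f by (blast intro: k_mono_subprobs_sq_summable)

text \<open>As \<open>g\<close> has mass 1, the constant shift contributes exactly
  \<open>beta_coef p f\<close>, the sum of (f - p) f. So pairing \<open>resid\<close> with
  \<open>g\<close> gives half the directional derivative from \<open>f\<close> towards
  \<open>g\<close>.\<close>

lemma sums_residual_mult:
  assumes "g \<in> k_mono_probs k"
  shows "(\<lambda>i. resid i * g i) sums (\<Sum>i. (f i - p i) * (g i - f i))"
proof -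
  let ?A = "\<Sum>i=0..s. (f i - p i) * g i"
  have A: "(\<lambda>i. (f i - p i) * g i) sums ?A"
    using f p by (intro sums_finite) auto
  have B: "(\<lambda>i. (f i - p i) * f i) sums beta_coef p f"
    unfolding beta_coef_eq using f(2)
    by (subst mult.commute) (intro sums_finite, auto)
  have "(\<lambda>i. (f i - p i) * g i - beta_coef p f * g i) sums (?A - beta_coef p f * 1)"
    using assms by (intro sums_diff A sums_mult) (simp add: k_mono_probs_def prob_mass_def)
  moreover have "(\<lambda>i. (f i - p i) * g i - (f i - p i) * f i) sums (?A - beta_coef p f)"
    by (intro sums_diff A B)
  ultimately show ?thesis
    by (simp add: resid_def algebra_simps sums_iff)
qed

lemma sq_dist_expand:
  assumes "g \<in> k_mono_probs k"
  shows "sq_dist g p = sq_dist f p + 2 * (\<Sum>i. resid i * g i) + (\<Sum>i. (g i - f i)\<^sup>2)"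
  using sums_unique[OF sums_square_add[OF summable_residual_sq summable_diff_sq[OF assms], of 1]]
    sums_unique[OF sums_residual_mult[OF assms]]
  by (simp add: sq_dist_def)

lemma minimizer_resid_nonneg:
  assumes min: "\<And>g. g \<in> k_mono_probs k \<Longrightarrow> sq_dist f p \<le> sq_dist g p"
    and g: "g \<in> k_mono_probs k"
  shows "(\<Sum>i. resid i * g i) \<ge> 0"
proof -
  have "(\<Sum>i. (f i - p i) * (g i - f i)) \<ge> 0"
  proof (rule first_order_condition[OF summable_residual_sq summable_diff_sq[OF g] zero_less_one])
    fix t :: real assume "0 < t" "t \<le> 1"
    then show "(\<Sum>i. (f i - p i)\<^sup>2) \<le> (\<Sum>i. (f i - p i + t * (g i - f i))\<^sup>2)"
      using min[OF k_mono_probs_convex[OF f(1) g, of t]] by (simp add: sq_dist_def algebra_simps)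
  qed
  then show ?thesis
    using sums_unique[OF sums_residual_mult[OF g]] by simp
qed

text \<open>\<open>arg_min\<close> selects some minimizer, so uniqueness is needed as well: by
  \<open>sq_dist_expand\<close>, the excess of \<open>g\<close> over \<open>f\<close> is at least
  the squared distance between them.\<close>

lemma eq_arg_min_of_resid_nonneg:
  assumes nonneg: "\<And>g. g \<in> k_mono_probs k \<Longrightarrow> (\<Sum>i. resid i * g i) \<ge> 0"
  shows "f = arg_min (\<lambda>g. sq_dist g p) (\<lambda>g. g \<in> k_mono_probs k)"
proof -
  have le: "sq_dist f p + (\<Sum>i. (g i - f i)\<^sup>2) \<le> sq_dist g p" if "g \<in> k_mono_probs k" for g
    using nonneg[OF that] sq_dist_expand[OF that] by simp
  have sq_nonneg: "(\<Sum>i. (g i - f i)\<^sup>2) \<ge> 0" if "g \<in> k_mono_probs k" for g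
    using summable_diff_sq[OF that] by (intro suminf_nonneg) auto
  have is_min: "is_arg_min (\<lambda>g. sq_dist g p) (\<lambda>g. g \<in> k_mono_probs k) f"
    unfolding is_arg_min_linorder using f(1) le sq_nonneg by (meson add_increasing2 order_refl order_trans)
  have "g = f" if "is_arg_min (\<lambda>g. sq_dist g p) (\<lambda>g. g \<in> k_mono_probs k) g" for g
  proof -
    from that have g: "g \<in> k_mono_probs k" "\<not> sq_dist f p < sq_dist g p"
      using f(1) by (auto simp: is_arg_min_def)
    then have "(\<Sum>i. (g i - f i)\<^sup>2) = 0"
      using le[OF g(1)] sq_nonneg[OF g(1)] by linarith
    then have "(g i - f i)\<^sup>2 = 0" for i
      using suminf_eq_zero_iff[OF summable_diff_sq[OF g(1)]] by simp
    then show ?thesis by (intro ext) simp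
  qed
  then show ?thesis
    unfolding arg_min_def using is_min by (metis (mono_tags, lifting) someI)
qed

text \<open>A k-monotone probability tends to 0, so its signed differences of all orders up to k are
  nonnegative. Every term of the k-fold summation by parts is then nonnegative once N \<ge> s + 1;
  the limit in N handles infinite supports of \<open>g\<close>.\<close>

lemma resid_nonneg_of_primitives:
  assumes inner: "\<And>l. primitive k resid l \<ge> 0"
    and boundary: "\<And>j l. 1 \<le> j \<Longrightarrow> j \<le> k \<Longrightarrow> l \<ge> s + 1 \<Longrightarrow> primitive j resid l \<ge> 0"
    and g: "g \<in> k_mono_probs k"
  shows "(\<Sum>i. resid i * g i) \<ge> 0"
proof (rule LIMSEQ_le_const)
  have summ: "summable (\<lambda>i. resid i * g i)"
    using sums_residual_mult[OF g] by (rule sums_summable)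
  then show "(\<lambda>N. \<Sum>i=0..N. resid i * g i) \<longlonglongrightarrow> (\<Sum>i. resid i * g i)"
    using summable_LIMSEQ' by (simp add: atLeast0AtMost)
  have mono: "0 \<le> (-1) ^ j * fdiff j g i" if "j \<le> k" for j i
    using k_monotone_lower[OF _ prob_mass_tendsto_0 that] g
    by (auto simp: k_mono_probs_def k_monotone_def)
  have "0 \<le> (\<Sum>i=0..N. resid i * g i)" if "N \<ge> s + 1" for N
    unfolding sum_mult_iterated_by_parts[of resid g N k]
    using that by (intro add_nonneg_nonneg sum_nonneg mult_nonneg_nonneg mono inner boundary) auto
  then show "\<exists>N. \<forall>n\<ge>N. 0 \<le> (\<Sum>i=0..n. resid i * g i)" by blast
qed

lemma minimizer_primitive_nonneg:
  assumes "\<And>g. g \<in> k_mono_probs k \<Longrightarrow> (\<Sum>i. resid i * g i) \<ge> 0"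
  shows "primitive k resid l \<ge> 0"
proof -
  let ?m = "spline_mass k l"
  have "0 \<le> (\<Sum>i. resid i * ((1 / ?m) * spline k l i))"
    by (intro assms normalized_spline_in_k_mono_probs k)
  also have "\<dots> = (\<Sum>i=0..l. resid i * ((1 / ?m) * spline k l i))"
    by (intro suminf_finite) (auto simp: spline_eq_0)
  also have "\<dots> = (1 / ?m) * primitive k resid l"
    by (simp add: sum_mult_spline[OF k, symmetric] sum_distrib_left mult_ac
        del: times_divide_eq_left mult_1_left)
  finally show ?thesis
    using spline_mass_pos[OF k, of l] by (simp add: zero_le_divide_iff)
qed

text \<open>Complementary slackness: the sum of \<open>resid\<close> against \<open>f\<close> is 0
  and, by parts, a sum of nonnegative products, so each product vanishes. At a knot the difference
  factor is positive.\<close>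

lemma primitive_eq_0_at_knot:
  assumes "\<And>l. primitive k resid l \<ge> 0" "k_knot k f l"
  shows "primitive k resid l = 0"
proof -
  have "l \<le> s"
    using assms(2) fdiff_eq_0[OF f(2), where i = l and k = k] by (force simp: k_knot_def)
  have "(\<Sum>i=0..s. primitive k resid i * ((-1) ^ k * fdiff k f i)) = 0"
    using sum_mult_eq_primitive_fdiff[of s f resid k] sum_resid_mult_self[of s] f(2) by simp
  moreover have "0 \<le> primitive k resid i * ((-1) ^ k * fdiff k f i)" for i
    using assms(1)[of i] f(1) by (simp add: k_mono_probs_def k_monotone_def)
  ultimately have "primitive k resid l * ((-1) ^ k * fdiff k f l) = 0"
    using \<open>l \<le> s\<close> by (subst (asm) sum_nonneg_eq_0_iff) auto
  moreover have "fdiff k f l \<noteq> 0"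
    using assms(2) by (auto simp: k_knot_def)
  ultimately show ?thesis by simp
qed

lemma beta_coef_nonpos:
  assumes "\<And>l. primitive k resid l \<ge> 0"
  shows "beta_coef p f \<le> 0"
proof (rule ccontr)
  assume "\<not> beta_coef p f \<le> 0"
  then have pos: "beta_coef p f > 0" by simp
  have neg: "primitive j (\<lambda>i. (-1) * resid i) l = - primitive j resid l" for j l
    unfolding primitive_cmult by simp
  \<comment> \<open>Past \<open>s\<close> the masses of \<open>f\<close> and \<open>p\<close>
    cancel, leaving only \<open>beta_coef p f * real (Suc l)\<close>.\<close>
  have "beta_coef p f \<le> primitive 1 (\<lambda>i. (-1) * resid i) l" if "l \<ge> s" for l
    unfolding neg primitive_1_resid[OF that] using pos by simp
  then have "eventually (\<lambda>l. beta_coef p f \<le> primitive 1 (\<lambda>i. (-1) * resid i) l) sequentially"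
    by (rule eventually_sequentiallyI)
  then obtain \<delta> where "\<delta> > 0" "eventually (\<lambda>l. \<delta> \<le> primitive k (\<lambda>i. (-1) * resid i) l) sequentially"
    using primitive_eventually_pos[OF pos _ k] by blast
  then obtain l where "\<delta> \<le> - primitive k resid l"
    unfolding neg by (auto simp: eventually_sequentially)
  with \<open>\<delta> > 0\<close> assms[of l] show False by simp
qed

text \<open>Beyond the support of \<open>f\<close>, whatever that of \<open>p\<close>, the first primitive of \<open>resid\<close> is
  \<open>1 - F\<^sub>p(l) - \<beta>(l + 1) \<ge> 0\<close>.\<close>

lemma primitive_1_resid_nonneg:
  assumes "beta_coef p f \<le> 0" "\<And>i. i > m \<Longrightarrow> f i = 0" "l \<ge> m"
  shows "primitive 1 resid l \<ge> 0"
proof -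
  have "(\<Sum>i=0..l. f i) = 1"
    using assms by (intro sum_prob_eq_1 prob_mass_f) auto
  moreover have "(\<Sum>i=0..l. p i) \<le> 1"
    using sum_le_of_prob_mass[OF p(1), of "Suc l"] by (simp add: atLeast0AtMost lessThan_Suc_atMost)
  moreover have "beta_coef p f * real (Suc l) \<le> 0"
    using assms(1) by (simp add: mult_nonpos_nonneg)
  ultimately show ?thesis
    by (simp add: resid_def sum_subtractf mult.commute)
qed

text \<open>The last support point is a knot, where \<open>H = primitive k resid\<close> attains its minimum \<open>0\<close>. This
  determines the signs of the first differences of \<open>H\<close> around it and hence of the second difference,
  but of no higher one: this restricts \<open>k\<close> to values up to \<open>4\<close>.\<close>

lemma lower_primitives_nonneg:
  assumes "k \<in> {3, 4}" and nonneg: "\<And>l. primitive k resid l \<ge> 0"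
    and m: "\<And>i. i > m \<Longrightarrow> f i = 0" "f m \<noteq> 0"
    and "2 \<le> j" "j \<le> k - 1" "l \<ge> m + 1"
  shows "primitive j resid l \<ge> 0"
proof -
  have beta: "beta_coef p f \<le> 0"
    using nonneg by (rule beta_coef_nonpos)
  have "f m > 0"
    using m(2) prob_mass_f by (metis order_le_less prob_mass_def)
  then have "k_knot k f m"
    using fdiff_at_last[OF m(1), where k = k] by (simp add: k_knot_def)
  with nonneg have zero: "primitive k resid m = 0"
    by (rule primitive_eq_0_at_knot)
  have H1: "primitive (k - 1) resid (Suc m) \<ge> 0"
    \<comment> \<open>The increment of the primitive of order k from its zero minimum at
      \<open>m\<close> to \<open>Suc m\<close>.\<close>
    using nonneg[of "Suc m"] zero k primitive_Suc_Suc[of "k - 1" resid m] by simp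
  have H1': "primitive (k - 1) resid m \<le> 0"
  proof (cases m)
    \<comment> \<open>At index 0 all primitives coincide, so the value is 0 instead of an
      increment.\<close>
    case 0
    then show ?thesis
      using zero k by (cases k) auto
  next
    case (Suc m')
    then show ?thesis
      using nonneg[of m'] zero k primitive_Suc_Suc[of "k - 1" resid m'] by simp
  qed
  \<comment> \<open>For k = 3 the value at \<open>m + 1\<close> is \<open>H1\<close>; for k = 4 it
    is the difference of \<open>H1\<close> and \<open>H1'\<close>. From there the nonnegative first
    primitive only increases it.\<close>
  have H2: "primitive 2 resid l \<ge> 0" if "l \<ge> m + 1" for l
  proof -
    have "primitive 2 resid (m + 1) \<ge> 0"
      using assms(1)
    proof
      assume "k \<in> {4}"
      then show ?thesis
        using H1 H1' primitive_Suc_Suc[of 2 resid m] by simp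
    qed (use H1 in simp)
    also have "primitive 2 resid (m + 1) \<le> primitive 2 resid l"
      using primitive_nonneg_mono[of m 1 resid "m + 1" l] primitive_1_resid_nonneg[OF beta m(1)] that
      by (simp only: numeral_2_eq_2 One_nat_def)
    finally show ?thesis .
  qed
  have H3: "primitive 3 resid l \<ge> 0" if "k = 4" "l \<ge> m + 1" for l
  proof -
    have "primitive (Suc 2) resid (m + 1) \<le> primitive (Suc 2) resid l"
      by (rule primitive_nonneg_mono[of "m + 1", OF H2]) (use that in auto)
    then show ?thesis
      using H1 \<open>k = 4\<close> by (simp del: primitive.simps)
  qed
  have "j = 2 \<or> j = 3 \<and> k = 4"
    using assms by auto
  then show ?thesis
    using H2 H3 \<open>l \<ge> m + 1\<close> by blast
qed

text \<open>Induction on the order: a primitive that is nonnegative from \<open>s + 1\<close> on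
  makes the next one increase there, from a nonnegative initial value. Order 1 rests on the sign of
  \<open>beta_coef p f\<close>.\<close>

lemma primitives_nonneg_of_initial:
  assumes init: "\<And>j. 2 \<le> j \<Longrightarrow> j \<le> k \<Longrightarrow> primitive j resid (s + 1) \<ge> 0"
    and "beta_coef p f \<le> 0" "1 \<le> j" "j \<le> k" "l \<ge> s + 1"
  shows "primitive j resid l \<ge> 0"
  using assms(3-5)
proof (induction j arbitrary: l rule: dec_induct)
  case base
  then show ?case
    using primitive_1_resid_nonneg[OF assms(2) f(2)] by simp
next
  case (step j)
  have "primitive (Suc j) resid (s + 1) \<le> primitive (Suc j) resid l"
    by (rule primitive_nonneg_mono[of "s + 1"]) (use step in auto)
  then show ?case
    using init[of "Suc j"] step by linarith
qed

end

section \<open>Both directions of the equivalence\<close>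

theorem theorem8:
  fixes k n s_f s_tilde s' :: nat
    and X :: "nat \<Rightarrow> nat"
    and f p :: "nat \<Rightarrow> real"
  assumes "k \<in> {3, 4}"
    and "n \<ge> 1"
    and "p = emp n X"
    and "f \<in> k_mono_probs k"
    and "finite (supp f)"
    and "s_f = Max (supp f)"
    and "s_tilde = Max (supp p)"
    and "s' = max s_f s_tilde"
  shows "((\<forall>l \<le> s' + 1. primitive k f l - primitive k p l \<ge> beta_coef p f * spline_mass k l)
        \<and> (\<forall>l. k_knot k f l \<longrightarrow>
              primitive k f l - primitive k p l = beta_coef p f * spline_mass k l)
        \<and> (\<forall>j. 2 \<le> j \<and> j \<le> k - 1 \<longrightarrow>
              primitive j f (s' + 1) - primitive j p (s' + 1) \<ge> beta_coef p f * spline_mass j (s' + 1))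
        \<and> beta_coef p f \<le> 0)
    \<longleftrightarrow> f = lse k n X"
proof -
  have k: "k \<ge> 1"
    using assms(1) by auto
  have p_mass: "prob_mass p"
    using assms(2,3) prob_mass_emp by simp
  have p0: "p i = 0" if "i > s'" for i
    using that assms(3,7,8) finite_supp_emp by (intro gt_Max_supp) auto
  have f0: "f i = 0" if "i > s_f" for i
    using that assms(5,6) by (intro gt_Max_supp) auto
  \<comment> \<open>Needed for \<open>Max (supp f)\<close> to be a genuine support point.\<close>
  have "supp f \<noteq> {}"
  proof
    assume "supp f = {}"
    then have "f = (\<lambda>_. 0)"
      by (auto simp: supp_def)
    then have "f sums 0"
      by simp
    moreover have "f sums 1"
      using assms(4) by (simp add: k_mono_probs_def prob_mass_def)
    ultimately show False
      using sums_unique2 zero_neq_one by blast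
  qed
  then have f_last: "f s_f \<noteq> 0"
    using Max_in[OF assms(5)] assms(6) by (simp add: supp_def)
  interpret finite_support_fit k s' p f
    using k p_mass p0 assms(4) f0 assms(8) by unfold_locales auto
  have lse: "lse k n X = arg_min (\<lambda>g. sq_dist g p) (\<lambda>g. g \<in> k_mono_probs k)"
    by (simp add: lse_def assms(3))
  have resid_iff: "primitive j f l - primitive j p l \<ge> beta_coef p f * spline_mass j l
      \<longleftrightarrow> primitive j resid l \<ge> 0" if "j \<ge> 1" for j l
    using primitive_resid[OF that, of l] by auto
  show ?thesis (is "?conds \<longleftrightarrow> _")
  proof
    assume ?conds
    then have d: "beta_coef p f \<le> 0"
      by blast
    have a: "primitive k resid l \<ge> 0" if "l \<le> s' + 1" for l
      using \<open>?conds\<close> that resid_iff[OF k] by blast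
    have c: "primitive j resid (s' + 1) \<ge> 0" if "2 \<le> j" "j \<le> k - 1" for j
      using \<open>?conds\<close> that resid_iff[of j "s' + 1"] by simp
    \<comment> \<open>Order k comes from (a) at its last index s' + 1, the intermediate orders from
      (c).\<close>
    have init: "primitive j resid (s' + 1) \<ge> 0" if "2 \<le> j" "j \<le> k" for j
      using that a[of "s' + 1"] c[of j] by (cases "j = k") auto
    have boundary: "primitive j resid l \<ge> 0" if "1 \<le> j" "j \<le> k" "l \<ge> s' + 1" for j l
      using init d that by (rule primitives_nonneg_of_initial)
    have inner: "primitive k resid l \<ge> 0" for l
      using a[of l] boundary[OF k, of l] by (cases "l \<le> s' + 1") auto
    show "f = lse k n X"
      unfolding lse
      by (intro eq_arg_min_of_resid_nonneg resid_nonneg_of_primitives inner boundary)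
  next
    assume "f = lse k n X"
    \<comment> \<open>\<open>lse\<close> is a choice term: being equal to it yields minimality only
      once some minimizer exists.\<close>
    have "\<exists>g\<in>k_mono_probs k. \<forall>h\<in>k_mono_probs k. sq_dist g p \<le> sq_dist h p"
      using k p_mass p0 by (rule k_mono_probs_minimizer_exists)
    then obtain g where "g \<in> k_mono_probs k" "\<forall>h\<in>k_mono_probs k. sq_dist g p \<le> sq_dist h p"
      by blast
    then have "is_arg_min (\<lambda>g. sq_dist g p) (\<lambda>g. g \<in> k_mono_probs k) g"
      by (auto simp: is_arg_min_def not_less)
    then have "is_arg_min (\<lambda>g. sq_dist g p) (\<lambda>g. g \<in> k_mono_probs k) (lse k n X)"
      unfolding lse arg_min_def by (rule someI[where P = "is_arg_min (\<lambda>g. sq_dist g p) (\<lambda>g. g \<in> k_mono_probs k)"])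
    then have "is_arg_min (\<lambda>g. sq_dist g p) (\<lambda>g. g \<in> k_mono_probs k) f"
      by (simp only: \<open>f = lse k n X\<close>)
    then have "sq_dist f p \<le> sq_dist g p" if "g \<in> k_mono_probs k" for g
      using that by (auto simp: is_arg_min_def not_less)
    then have "(\<Sum>i. resid i * g i) \<ge> 0" if "g \<in> k_mono_probs k" for g
      using that by (rule minimizer_resid_nonneg)
    then have nonneg: "primitive k resid l \<ge> 0" for l
      by (rule minimizer_primitive_nonneg)
    have "primitive k f l - primitive k p l = beta_coef p f * spline_mass k l" if "k_knot k f l" for l
      using primitive_eq_0_at_knot[OF nonneg that] primitive_resid[OF k, of l] by simp
    moreover have "primitive j resid (s' + 1) \<ge> 0" if "2 \<le> j" "j \<le> k - 1" for j
      \<comment> \<open>Applied at the last support point \<open>s_f\<close> of \<open>f\<close>,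
        which is a knot even when the support of \<open>p\<close> extends further.\<close>
      using assms(1) nonneg f0 f_last that
      by (rule lower_primitives_nonneg[where m = s_f]) (use assms(8) in auto)
    ultimately show ?conds
      using nonneg beta_coef_nonpos[OF nonneg] k resid_iff by auto
  qed
qed

end
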